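(* Let $n,k\in\mathbb{Z}^+$, let $p_j$ denote the $j$-th prime, $P_{k,n}=\{p_n,\dots,p_{n+k-1}\}$ and $N=p_n p_{n+1}\cdots p_{n+k-1}$. Define the unary promise problem $\mathtt{L^{k,n}}=(\mathtt{L^{k,n}_{yes}},\mathtt{L^{k,n}_{no}})$ by $\mathtt{L^{k,n}_{yes}}=\{a^m\mid m\equiv 0\pmod N\}$ and $\mathtt{L^{k,n}_{no}}=\{a^m\mid m\bmod p_j\in[\frac{p_j}{8},\frac{3p_j}{8}]\cup[\frac{5p_j}{8},\frac{7p_j}{8}]\text{ for at least }\frac{2k}{3}\text{ different }p_j\in P_{k,n}\}$. Then any probabilistic finite automaton solving $\mathtt{L^{k,n}}$ with some error bound $\epsilon<\frac12$ has $\Omega(k(n+k)\log n)$ states (the implied constant being independent of $n$ and $k$).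
   Context: A probabilistic finite automaton (PFA) is $(Q,\Sigma,\{A_\sigma\}_{\sigma\in\Sigma},v_0,Q_a)$ with finite state set $Q$, column-stochastic matrices $A_\sigma$, stochastic initial vector $v_0$ and accepting set $Q_a$; on input $w=w_1\cdots w_\ell$ the final vector is $v_\ell=A_{w_\ell}\cdots A_{w_1}v_0$ and the acceptance probability is $\sum_{q_j\in Q_a}v_\ell(j)$. A PFA solves a promise problem $(\mathtt{P_{yes}},\mathtt{P_{no}})$ with error bound $\epsilon<\frac12$ if every yes-instance is accepted with probability at least $1-\epsilon$ and every no-instance is rejected with probability at least $1-\epsilon$. *)

theory Defs
  imports
    Complex_Main
    "HOL-Library.Infinite_Set"
    "HOL-Number_Theory.Cong"
    "HOL-Computational_Algebra.Primes"
    "Jordan_Normal_Form.Matrix"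
begin

definition stochastic_vec :: "nat \<Rightarrow> real vec \<Rightarrow> bool" where
  "stochastic_vec d v \<longleftrightarrow> v \<in> carrier_vec d \<and> (\<forall>i<d. 0 \<le> v $ i) \<and> (\<Sum>i<d. v $ i) = 1"

definition column_stochastic_mat :: "nat \<Rightarrow> real mat \<Rightarrow> bool" where
  "column_stochastic_mat d A \<longleftrightarrow>
     A \<in> carrier_mat d d \<and> (\<forall>j<d. stochastic_vec d (col A j))"

text \<open>The states of an automaton are the matrix indices \<open>0, \<dots>, num_states - 1\<close>. A fixed index
  type, rather than a type of states, lets a bound on the number of states hold uniformly over
  automata of all sizes.\<close>

record 'a pfa =
  num_states :: nat
  alphabet :: "'a set"
  transition_mat :: "'a \<Rightarrow> real mat"
  initial_vec :: "real vec"
  accepting_states :: "nat set"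

definition is_pfa :: "'a pfa \<Rightarrow> bool" where
  "is_pfa M \<longleftrightarrow>
     finite (alphabet M) \<and>
     (\<forall>\<sigma>\<in>alphabet M. column_stochastic_mat (num_states M) (transition_mat M \<sigma>)) \<and>
     stochastic_vec (num_states M) (initial_vec M) \<and>
     accepting_states M \<subseteq> {..<num_states M}"

definition final_vec :: "'a pfa \<Rightarrow> 'a list \<Rightarrow> real vec" where
  "final_vec M w = foldl (\<lambda>v \<sigma>. transition_mat M \<sigma> *\<^sub>v v) (initial_vec M) w"

definition accept_prob :: "'a pfa \<Rightarrow> 'a list \<Rightarrow> real" where
  "accept_prob M w = (\<Sum>j\<in>accepting_states M. final_vec M w $ j)"

definition reject_prob :: "'a pfa \<Rightarrow> 'a list \<Rightarrow> real" where
  "reject_prob M w = 1 - accept_prob M w"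

text \<open>A promise problem is given by its yes-instances and its no-instances.\<close>

type_synonym 'a promise_problem = "'a list set \<times> 'a list set"

definition solves_with_error :: "'a pfa \<Rightarrow> 'a promise_problem \<Rightarrow> real \<Rightarrow> bool" where
  "solves_with_error M P \<epsilon> \<longleftrightarrow>
     fst P \<union> snd P \<subseteq> lists (alphabet M) \<and>
     (\<forall>w\<in>fst P. accept_prob M w \<ge> 1 - \<epsilon>) \<and>
     (\<forall>w\<in>snd P. reject_prob M w \<ge> 1 - \<epsilon>)"

text \<open>Primes are counted from one, so \<open>nth_prime 1 = 2\<close>, whereas \<^const>\<open>enumerate\<close> starts at zero.\<close>

definition nth_prime :: "nat \<Rightarrow> nat" where
  "nth_prime j = enumerate {p. prime p} (j - 1)"

definition prime_block :: "nat \<Rightarrow> nat \<Rightarrow> nat set" where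
  "prime_block k n = nth_prime ` {n..<n + k}"

definition L_yes :: "'a \<Rightarrow> nat \<Rightarrow> nat \<Rightarrow> 'a list set" where
  "L_yes a k n = {replicate m a | m. [m = 0] (mod (\<Prod>p\<in>prime_block k n. p))}"

definition L_no :: "'a \<Rightarrow> nat \<Rightarrow> nat \<Rightarrow> 'a list set" where
  "L_no a k n = {replicate m a | m.
     real (card {p \<in> prime_block k n.
        real (m mod p) \<in> {real p / 8..3 * real p / 8} \<union> {5 * real p / 8..7 * real p / 8}})
     \<ge> 2 * real k / 3}"

definition L_problem :: "'a \<Rightarrow> nat \<Rightarrow> nat \<Rightarrow> 'a promise_problem" where
  "L_problem a k n = (L_yes a k n, L_no a k n)"

end

theory Submission
  imports Defs "HOL-Combinatorics.Orbits"
begin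

text \<open>
  Choose for every state one successor of positive probability; the cycles of this map are
  disjoint, so their lengths sum to at most the number of states. Let \<open>L\<close> be the product of the
  cycle lengths. In the \<open>L\<close>-step chain every state reaches a state with a loop, so the chain has no
  periodic behaviour left, and the acceptance probabilities of \<open>a^(L m)\<close> and \<open>a^(L (m + 1))\<close> become
  indistinguishable as \<open>m\<close> grows. If fewer than a third of the primes of the block divided \<open>L\<close>, the
  Chinese remainder theorem would give infinitely many no-instances \<open>a^(L m)\<close>, at bounded distance from
  yes-instances of the same form, which is impossible for \<open>\<epsilon> < 1/2\<close>. Hence at least a third of the
  primes divide cycle lengths. As distinct primes dividing one cycle length have a sum at most that
  length, the number of states is at least the sum of these primes; and \<open>p\<^sub>j\<close> is at least of order
  \<open>j ln j\<close> because \<open>j! \<le> p\<^sub>1 \<cdots> p\<^sub>j \<le> 8^p\<^sub>j\<close>.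
\<close>

subsection \<open>A lower bound for the primes\<close>

lemma prod_primes_dvd:
  fixes n :: nat
  assumes "finite D" "\<And>p. p \<in> D \<Longrightarrow> prime p \<and> p dvd n"
  shows "\<Prod>D dvd n"
  using assms
proof (induction D rule: finite_induct)
  case (insert p D)
  have "coprime p (\<Prod>D)"
    using insert by (intro prod_coprime_right) (metis insertCI primes_coprime)
  then show ?case
    using insert by (simp add: divides_mult)
qed simp

lemma sum_le_prod:
  fixes D :: "nat set"
  assumes "finite D" "D \<noteq> {}" "\<And>p. p \<in> D \<Longrightarrow> p \<ge> 2"
  shows "\<Sum>D \<le> \<Prod>D"
  using assms
proof (induction D rule: finite_ne_induct)
  case (insert p D)
  have "\<Prod>D \<ge> 2"
  proof -
    obtain q where q: "q \<in> D" using insert by blast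
    have "1 \<le> \<Prod>(D - {q})" using insert.prems
      by (intro prod_ge_1) (metis DiffD1 insertCI one_le_numeral order_trans)
    moreover have "q \<ge> 2" using q insert by simp
    moreover have "\<Prod>D = q * \<Prod>(D - {q})" using q insert by (simp add: prod.remove)
    ultimately show ?thesis by (metis mult.right_neutral mult_le_mono)
  qed
  moreover have "p + b \<le> p * b" if "p \<ge> 2" "b \<ge> 2" for b :: nat
  proof -
    define i j where "i = p - 2" and "j = b - 2"
    have "p = i + 2" "b = j + 2" using that by (simp_all add: i_def j_def)
    then show ?thesis by (simp add: algebra_simps)
  qed
  moreover have "\<Sum>D \<le> \<Prod>D" using insert by simp
  moreover have "p \<ge> 2" using insert by simp
  ultimately have "p + \<Sum>D \<le> p * \<Prod>D" by (meson add_left_mono le_trans)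
  then show ?case using insert.hyps by simp
qed simp

text \<open>The product of distinct primes dividing \<open>n\<close> divides \<open>n\<close>, and
  numbers from 2 on have a sum at most their product. Applied to a cycle length, it bounds the cost
  of all block primes contained in that length.\<close>

lemma sum_prime_divisors_le:
  fixes n :: nat
  assumes "n > 0" "finite D" "\<And>p. p \<in> D \<Longrightarrow> prime p \<and> p dvd n"
  shows "\<Sum>D \<le> n"
proof (cases "D = {}")
  case False
  then have "\<Sum>D \<le> \<Prod>D" using assms by (intro sum_le_prod) (auto simp: prime_ge_2_nat)
  also have "\<dots> \<le> n" using prod_primes_dvd[of D n] assms by (intro dvd_imp_le) auto
  finally show ?thesis .
qed simp

text \<open>Chebyshev's argument: with \<open>h\<close> half of \<open>n\<close> rounded up, every
  prime above \<open>h\<close> and up to \<open>n\<close> divides \<open>n choose (n div 2)\<close>,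
  which is at most \<open>2 ^ n\<close>. The primes up to \<open>h\<close> are handled by
  induction.\<close>

lemma primorial_le: "\<Prod>{p::nat. prime p \<and> p \<le> n} \<le> 8 ^ n"
proof (induction n rule: less_induct)
  case (less n)
  show ?case
  proof (cases "n < 2")
    case True
    then have none: "{p::nat. prime p \<and> p \<le> n} = {}"
      by (auto dest!: prime_ge_2_nat)
    show ?thesis unfolding none by simp
  next
    case False
    define j where "j = n div 2"
    define h where "h = n - j"
    let ?lo = "{p::nat. prime p \<and> p \<le> h}" and ?hi = "{p::nat. prime p \<and> h < p \<and> p \<le> n}"
    have "\<Prod>?hi dvd n choose j"
    proof (rule prod_primes_dvd)
      fix p assume "p \<in> ?hi"
      then have p: "prime p" "h < p" "p \<le> n" by auto
      have "p dvd fact j * fact h * (n choose j)"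
        using p binomial_fact_lemma[of j n] by (simp add: h_def j_def prime_dvd_fact_iff)
      moreover have "\<not> p dvd fact j" "\<not> p dvd fact h"
        using p by (auto simp: prime_dvd_fact_iff h_def j_def)
      ultimately show "prime p \<and> p dvd n choose j" using p by (simp add: prime_dvd_mult_iff)
    qed simp
    moreover have "n choose j > 0" by (simp add: j_def)
    ultimately have hi: "\<Prod>?hi \<le> 2 ^ n"
      using binomial_le_pow2 dvd_imp_le le_trans by blast
    have lo: "\<Prod>?lo \<le> 8 ^ h"
      using less[of h] False by (simp add: h_def j_def)
    have "{p::nat. prime p \<and> p \<le> n} = ?lo \<union> ?hi" by (auto simp: h_def)
    then have "\<Prod>{p::nat. prime p \<and> p \<le> n} = \<Prod>?lo * \<Prod>?hi"
      by (simp only:) (rule prod.union_disjoint, auto)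
    also have "\<dots> \<le> 8 ^ h * 2 ^ n" using lo hi by (rule mult_le_mono)
    also have "\<dots> = 2 ^ (3 * h + n)" by (simp add: power_add power_mult)
    \<comment> \<open>This needs \<open>3 * h <= 2 * n\<close>, which holds from
      \<open>n = 2\<close> on, with equality at \<open>n = 3\<close>, but fails at
      \<open>n = 1\<close>; hence the case split.\<close>
    also have "\<dots> \<le> 2 ^ (3 * n)"
      using False by (intro power_increasing) (auto simp: h_def j_def)
    also have "\<dots> = 8 ^ n" by (simp add: power_mult)
    finally show ?thesis .
  qed
qed

text \<open>Pairing the factor \<open>i\<close> of one factorial with \<open>n + 1 - i\<close> of
  the other gives \<open>n\<close> products, each at least \<open>n\<close> because
  \<open>(a + 1) * (b + 1) >= a + 1 + b\<close>.\<close>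

lemma power_self_le_fact_square: "n ^ n \<le> (fact n :: nat)\<^sup>2"
proof -
  have *: "n \<le> i * (n + 1 - i)" if i: "i \<in> {1..n}" for i
  proof -
    define a b where "a = i - 1" and "b = n - i"
    have "i = a + 1" "n = a + 1 + b" using i by (simp_all add: a_def b_def)
    then show ?thesis by (simp add: algebra_simps)
  qed
  have "n ^ n = (\<Prod>i=1..n. n)" by simp
  also have "\<dots> \<le> (\<Prod>i=1..n. i * (n + 1 - i))" by (intro prod_mono) (use * in auto)
  also have "\<dots> = (\<Prod>i=1..n. i) * (\<Prod>i=1..n. n + 1 - i)" by (rule prod.distrib)
  also have "(\<Prod>i=1..n. n + 1 - i) = (\<Prod>i=1..n. i)"
    by (rule prod.reindex_bij_witness[of _ "\<lambda>i. n + 1 - i" "\<lambda>i. n + 1 - i"]) auto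
  finally show ?thesis by (simp add: fact_prod power2_eq_square)
qed

lemma prime_nth_prime: "prime (nth_prime j)"
  using enumerate_in_set[OF primes_infinite] by (simp add: nth_prime_def)

lemma enumerate_primes_ge: "i + 2 \<le> enumerate {p::nat. prime p} i"
proof (induction i)
  case 0
  then show ?case using enumerate_in_set[OF primes_infinite, of 0]
    by (metis CollectD prime_ge_2_nat add_0)
next
  case (Suc i)
  then show ?case using enumerate_step[OF primes_infinite, of i] by simp
qed

lemma nth_prime_gt: "j < nth_prime j"
  using enumerate_primes_ge[of "j - 1"] by (simp add: nth_prime_def)

text \<open>Index 0 is excluded: truncated subtraction makes \<open>nth_prime 0\<close> equal to
  \<open>nth_prime 1\<close>.\<close>

lemma inj_on_nth_prime: "inj_on nth_prime {1..}"
proof (rule inj_onI)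
  fix i j :: nat
  assume ij: "i \<in> {1..}" "j \<in> {1..}" "nth_prime i = nth_prime j"
  then have "i - 1 = j - 1"
    using inj_enumerate[OF primes_infinite] by (simp add: nth_prime_def inj_eq)
  then show "i = j" using ij by simp
qed

lemma nth_prime_mono: "i \<le> j \<Longrightarrow> nth_prime i \<le> nth_prime j"
  using enumerate_mono_le_iff[OF primes_infinite] by (simp add: nth_prime_def diff_le_mono)

text \<open>Logarithms are taken in \<open>j ^ j <= (fact j)^2 <= 8 ^ (2 * nth_prime j)\<close>; the
  square puts the 2 next to \<open>ln 8\<close>.\<close>

lemma nth_prime_lower_bound:
  assumes "j \<ge> 1"
  shows "real j * ln (real j) / (2 * ln 8) \<le> real (nth_prime j)"
proof -
  have "fact j = (\<Prod>i=1..j. i)" by (simp add: fact_prod)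
  also have "\<dots> \<le> (\<Prod>i=1..j. nth_prime i)"
    by (intro prod_mono) (use nth_prime_gt in \<open>auto intro: less_imp_le\<close>)
  also have "\<dots> = \<Prod>(nth_prime ` {1..j})"
    by (subst prod.reindex) (auto intro: inj_on_subset[OF inj_on_nth_prime])
  also have "\<dots> \<le> \<Prod>{p. prime p \<and> p \<le> nth_prime j}"
    by (intro dvd_imp_le prod_dvd_prod_subset prod_pos)
      (auto simp: prime_nth_prime nth_prime_mono prime_gt_0_nat)
  also have "\<dots> \<le> 8 ^ nth_prime j" by (rule primorial_le)
  finally have "(fact j :: nat) \<le> 8 ^ nth_prime j" .
  then have "j ^ j \<le> (8 ^ nth_prime j)\<^sup>2"
    using power_self_le_fact_square[of j] by (meson le_trans power_mono zero_le)
  then have "real (j ^ j) \<le> real ((8 ^ nth_prime j)\<^sup>2)" by (simp only: of_nat_le_iff)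
  then have "ln (real j ^ j) \<le> ln ((8 ^ nth_prime j)\<^sup>2)"
    using assms by (intro ln_mono) auto
  then have "real j * ln (real j) \<le> 2 * (real (nth_prime j) * ln 8)"
    using assms by (simp add: ln_realpow)
  then show ?thesis by (simp add: divide_le_eq mult.commute mult.left_commute)
qed

section \<open>Sums over large subsets of a block\<close>

lemma sum_lessThan_card_le: "finite J \<Longrightarrow> \<Sum>{..<card J} \<le> \<Sum>J" for J :: "nat set"
proof (induction "card J" arbitrary: J)
  case (Suc t)
  then have ne: "J \<noteq> {}" by auto
  let ?J = "J - {Max J}"
  have c: "card ?J = t" using Suc ne by simp
  have "J \<subseteq> {..Max J}" using Suc by auto
  \<comment> \<open>The largest of \<open>t + 1\<close> distinct naturals is at least
    \<open>t\<close>; the others fall under the induction hypothesis.\<close>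
  then have "Suc t \<le> Suc (Max J)" using Suc.hyps(2) card_mono[of "{..Max J}" J] by simp
  moreover have "\<Sum>{..<t} \<le> \<Sum>?J" using Suc.hyps(1)[of ?J] c Suc.prems by simp
  moreover have "\<Sum>J = Max J + \<Sum>?J" using Suc.prems ne by (intro sum.remove) auto
  ultimately show ?case using Suc.hyps(2)[symmetric] by simp
qed simp

text \<open>Distinctness gives a sum of at least \<open>t * (t - 1) / 2\<close>, the lower end
  \<open>n\<close> one of at least \<open>t * n\<close>. With \<open>t >= k / 3\<close> these yield
  the \<open>k * k\<close> and the \<open>k * n\<close> part; \<open>n >= 2\<close> absorbs the term
  \<open>- t\<close>.\<close>

lemma sum_indices_lower_bound:
  fixes n k :: nat
  assumes n: "n \<ge> 2" and J: "J \<subseteq> {n..}" "finite J" and c: "real (card J) \<ge> real k / 3"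
  shows "real k * (real n + real k) / 36 \<le> real (\<Sum>J)"
proof -
  define t where "t = card J"
  have "real (2 * \<Sum>{..<t}) = real t * (real t - 1)"
    by (induction t) (simp_all add: algebra_simps)
  then have 1: "real t * (real t - 1) \<le> 2 * real (\<Sum>J)"
    using sum_lessThan_card_le[OF J(2)] by (simp add: t_def flip: of_nat_sum)
  have "t * n \<le> \<Sum>J" using sum_bounded_below[of J n "\<lambda>i. i"] J by (auto simp: t_def)
  then have 2: "real t * real n \<le> real (\<Sum>J)" by (metis of_nat_le_iff of_nat_mult)
  have tk: "real t \<ge> real k / 3" using c by (simp add: t_def)
  have "real k / 3 * real n \<le> real t * real n" using tk by (intro mult_right_mono) auto
  moreover have "(real k / 3)\<^sup>2 \<le> (real t)\<^sup>2" using tk by (intro power_mono) auto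
  moreover have "real t * 2 \<le> real t * real n" using n by (intro mult_left_mono) auto
  ultimately show ?thesis using 1 2 by (simp add: power2_eq_square algebra_simps)
qed

text \<open>A block prime with index \<open>j >= n\<close> is at least
  \<open>j * ln n / (2 * ln 8)\<close>, so the bound for the sum of the indices carries over; 72 is
  36 times 2.\<close>

lemma sum_prime_block_subset_ge:
  assumes n: "n \<ge> 2" and D: "D \<subseteq> prime_block k n" and c: "real (card D) \<ge> real k / 3"
  shows "1 / (72 * ln 8) * (real k * (real n + real k) * ln (real n)) \<le> real (\<Sum>D)"
proof -
  obtain J where J: "J \<subseteq> {n..<n + k}" "D = nth_prime ` J"
    using D unfolding prime_block_def by (auto simp: subset_image_iff)
  have inj: "inj_on nth_prime J"
    using J n by (intro inj_on_subset[OF inj_on_nth_prime]) auto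
  have fin: "finite J" using J finite_subset by blast
  have "real k * (real n + real k) / 36 \<le> real (\<Sum>J)"
    using J fin c inj n by (intro sum_indices_lower_bound) (auto simp: card_image)
  then have "real k * (real n + real k) / 36 * (ln (real n) / (2 * ln 8)) \<le>
      real (\<Sum>J) * (ln (real n) / (2 * ln 8))"
    using n by (intro mult_right_mono) auto
  also have "\<dots> = (\<Sum>j\<in>J. real j * ln (real n) / (2 * ln 8))"
    by (simp add: sum_distrib_right sum_divide_distrib)
  also have "\<dots> \<le> (\<Sum>j\<in>J. real (nth_prime j))"
  proof (rule sum_mono)
    fix j assume "j \<in> J"
    then have j: "n \<le> j" using J by auto
    then have "real j * ln (real n) / (2 * ln 8) \<le> real j * ln (real j) / (2 * ln 8)"
      using n by (intro divide_right_mono mult_left_mono) auto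
    also have "\<dots> \<le> real (nth_prime j)" using j n by (intro nth_prime_lower_bound) simp
    finally show "real j * ln (real n) / (2 * ln 8) \<le> real (nth_prime j)" .
  qed
  also have "\<dots> = real (\<Sum>D)" using J inj by (simp add: sum.reindex)
  finally show ?thesis by (simp add: field_simps)
qed

subsection \<open>Cycles of a finite self-map\<close>

lemma funpow_card_orbit:
  assumes "x \<in> orbit f x"
  shows "(f ^^ card (orbit f x)) x = x"
proof -
  have "card (orbit f x) = funpow_dist1 f x x"
    by (subst orbit_conv_funpow_dist1[OF assms], subst card_image)
      (auto intro: inj_on_funpow_dist1[OF assms])
  then show ?thesis using funpow_dist1_prop[OF assms] by simp
qed

lemma funpow_mult_fixed: "(f ^^ c) x = x \<Longrightarrow> (f ^^ (c * m)) x = x"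
  by (induction m) (simp_all add: funpow_add)

text \<open>Every point enters a cycle, and \<open>f ^^ L\<close> fixes all points on cycles when
  \<open>L\<close> is a common multiple of the cycle lengths. The last claim charges each prime
  divisor of \<open>L\<close> to the cycles whose length it divides; disjoint cycles fit into
  \<open>S\<close> together.\<close>

lemma finite_self_map_cycles:
  fixes f :: "'a \<Rightarrow> 'a"
  assumes fin: "finite S" and f: "\<And>x. x \<in> S \<Longrightarrow> f x \<in> S"
  obtains L where "L > 0"
    and "\<And>x. x \<in> S \<Longrightarrow> \<exists>n. (f ^^ L) ((f ^^ (L * n)) x) = (f ^^ (L * n)) x"
    and "\<And>D. finite D \<Longrightarrow> (\<And>p. p \<in> D \<Longrightarrow> prime p \<and> p dvd L) \<Longrightarrow> \<Sum>D \<le> card S"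
proof -
  define C where "C = {orbit f x |x. x \<in> S \<and> x \<in> orbit f x}"
  \<comment> \<open>The product runs over the set of lengths, so equal lengths count once. What
    matters is that each cycle length divides \<open>L\<close> and each prime divisor of
    \<open>L\<close> divides some cycle length.\<close>
  define L where "L = \<Prod>(card ` C)"
  have fS: "(f ^^ n) x \<in> S" if "x \<in> S" for n x
    using that f by (induction n) auto
  have orb: "orbit f x \<subseteq> S" if "x \<in> S" for x
    using fS[OF that] by (auto simp: orbit_altdef)
  have CS: "\<Union>C \<subseteq> S" using orb by (auto simp: C_def)
  have finC: "finite C" using CS fin by (meson finite_UnionD finite_subset)
  have finO: "finite O'" if "O' \<in> C" for O' using that CS fin by (meson Union_upper finite_subset)
  have posO: "card O' > 0" if "O' \<in> C" for O'
    using that finO[OF that] orbit_nonempty by (auto simp: card_gt_0_iff C_def)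
  have disj: "A \<inter> B = {}" if "A \<in> C" "B \<in> C" "A \<noteq> B" for A B
  proof (rule ccontr)
    have cyc: "cyclic_on f A" "cyclic_on f B"
      using that by (auto simp: C_def cyclic_on_def)
    assume "A \<inter> B \<noteq> {}"
    then obtain z where "z \<in> A" "z \<in> B" by blast
    then show False using orbit_cyclic_eq3[OF cyc(1)] orbit_cyclic_eq3[OF cyc(2)] that by metis
  qed
  show thesis
  proof
    show L: "L > 0" using posO by (auto simp: L_def intro!: prod_pos)
    fix x assume x: "x \<in> S"
    have "\<not> inj_on (\<lambda>n. (f ^^ n) x) UNIV"
      using fS[OF x] fin by (metis finite_imageD finite_subset image_subsetI infinite_UNIV_nat)
    then obtain a b where ab: "a < b" "(f ^^ a) x = (f ^^ b) x"
      unfolding inj_on_def by (metis linorder_neqE_nat)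
    have per: "(f ^^ (b - a)) ((f ^^ a) x) = (f ^^ a) x"
      using ab by (metis comp_apply funpow_add le_add_diff_inverse2 less_imp_le)
    \<comment> \<open>After \<open>a\<close> steps the trajectory is on its cycle;
      \<open>L * a\<close> is a multiple of \<open>L\<close> and at least \<open>a\<close>.\<close>
    define y where "y = (f ^^ (L * a)) x"
    have y: "y = (f ^^ (L * a - a)) ((f ^^ a) x)"
      using L by (simp add: y_def flip: funpow_add[THEN fun_cong, unfolded o_apply])
    have "(f ^^ a) x \<in> orbit f ((f ^^ a) x)"
      using per ab by (subst orbit_altdef) (force intro: exI[of _ "b - a"])
    then have "y \<in> orbit f y"
      unfolding y by (meson funpow_in_orbit self_in_orbit_trans)
    moreover have "y \<in> S" unfolding y_def by (rule fS[OF x])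
    ultimately have "orbit f y \<in> C" by (auto simp: C_def)
    then have "card (orbit f y) dvd L" 
      using finC by (auto simp: L_def)
    then have "(f ^^ L) y = y"
      using funpow_mult_fixed[OF funpow_card_orbit[OF \<open>y \<in> orbit f y\<close>]] by (metis dvdE)
    then show "\<exists>n. (f ^^ L) ((f ^^ (L * n)) x) = (f ^^ (L * n)) x"
      unfolding y_def by blast
  next
    fix D :: "nat set"
    assume D: "finite D" "\<And>p. p \<in> D \<Longrightarrow> prime p \<and> p dvd L"
    have "\<exists>A\<in>C. p dvd card A" if "p \<in> D" for p
      using D(2)[OF that] finC by (auto simp: L_def prime_dvd_prod_iff)
    \<comment> \<open>Double counting of pairs of a prime and a cycle whose length it divides: every
      prime occurs at least once, and the primes at one cycle sum to at most its length.\<close>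
    then have "p \<le> (\<Sum>A | A \<in> C \<and> p dvd card A. p)" if "p \<in> D" for p
      using that finC by (auto simp: card_gt_0_iff Suc_le_eq)
    then have "\<Sum>D \<le> (\<Sum>p\<in>D. \<Sum>A | A \<in> C \<and> p dvd card A. p)"
      by (rule sum_mono)
    also have "\<dots> = (\<Sum>A\<in>C. \<Sum>p | p \<in> D \<and> p dvd card A. p)"
      using D(1) finC by (rule sum.swap_restrict)
    also have "\<dots> \<le> (\<Sum>A\<in>C. card A)"
      using D posO by (intro sum_mono sum_prime_divisors_le) auto
    also have "\<dots> = card (\<Union>C)"
      using finO disj by (intro card_Union_disjoint[symmetric]) (auto simp: pairwise_def disjnt_def)
    also have "\<dots> \<le> card S" using CS fin by (rule card_mono[rotated])
    finally show "\<Sum>D \<le> card S" .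
  qed
qed

subsection \<open>Finite Markov chains in which every state reaches a loop\<close>

text \<open>Rows sum to one, so \<open>K\<close> averages functions of the state; a
  column-stochastic matrix enters transposed. The carrier is an arbitrary set so that pairs of
  states and closed classes are covered too.\<close>

definition stochastic_kernel :: "'a set \<Rightarrow> ('a \<Rightarrow> 'a \<Rightarrow> real) \<Rightarrow> bool" where
  "stochastic_kernel S K \<longleftrightarrow>
     finite S \<and> (\<forall>x\<in>S. \<forall>y\<in>S. 0 \<le> K x y) \<and> (\<forall>x\<in>S. (\<Sum>y\<in>S. K x y) = 1)"

definition kernel_edges :: "'a set \<Rightarrow> ('a \<Rightarrow> 'a \<Rightarrow> real) \<Rightarrow> ('a \<times> 'a) set" where
  "kernel_edges S K = {(x, y). x \<in> S \<and> y \<in> S \<and> K x y > 0}"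

text \<open>At a maximum point the weighted sum of the nonnegative gaps \<open>M - G v\<close> is at
  most 0, so every successor of positive weight is a maximum point as well. The maximum spreads
  along edges to a point where \<open>G\<close> is at most 0.\<close>

lemma subharmonic_max_principle:
  fixes G :: "'a \<Rightarrow> real"
  assumes K: "stochastic_kernel S K"
    and sub: "\<And>x. x \<in> S \<Longrightarrow> G x \<le> (\<Sum>y\<in>S. K x y * G y)"
    and reach: "\<And>x. x \<in> S \<Longrightarrow> \<exists>z. (x, z) \<in> (kernel_edges S K)\<^sup>* \<and> G z \<le> 0"
    and x: "x \<in> S"
  shows "G x \<le> 0"
proof -
  have fin: "finite S" and nonneg: "\<And>x y. x \<in> S \<Longrightarrow> y \<in> S \<Longrightarrow> 0 \<le> K x y"
    and sum1: "\<And>x. x \<in> S \<Longrightarrow> (\<Sum>y\<in>S. K x y) = 1"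
    using K by (auto simp: stochastic_kernel_def)
  define M where "M = Max (G ` S)"
  have le_M: "G y \<le> M" if "y \<in> S" for y using that fin by (simp add: M_def)
  obtain x0 where x0: "x0 \<in> S" "G x0 = M"
    using Max_in[of "G ` S"] fin x unfolding M_def by fastforce
  obtain z where z: "(x0, z) \<in> (kernel_edges S K)\<^sup>*" "G z \<le> 0" using reach[OF x0(1)] by blast
  from z(1) have "z \<in> S \<and> G z = M"
  proof (induction rule: rtrancl_induct)
    case base
    show ?case using x0 by simp
  next
    case (step y w)
    then have y: "y \<in> S" "G y = M" and w: "w \<in> S" "K y w > 0" by (auto simp: kernel_edges_def)
    have "(\<Sum>v\<in>S. K y v * (M - G v)) = M - (\<Sum>v\<in>S. K y v * G v)"
      using sum1[OF y(1)] by (simp add: right_diff_distrib sum_subtractf flip: sum_distrib_right)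
    also have "\<dots> \<le> 0" using sub[OF y(1)] y(2) by simp
    finally have "(\<Sum>v\<in>S. K y v * (M - G v)) \<le> 0" .
    moreover have "0 \<le> (\<Sum>v\<in>S. K y v * (M - G v))"
      using nonneg y(1) le_M by (intro sum_nonneg mult_nonneg_nonneg) auto
    ultimately have "(\<Sum>v\<in>S. K y v * (M - G v)) = 0" by (rule antisym)
    then have "K y w * (M - G w) = 0"
      using nonneg y(1) le_M fin w(1) by (subst (asm) sum_nonneg_eq_0_iff) auto
    then show ?case using w by simp
  qed
  then show ?thesis using le_M[OF x] z(2) by simp
qed

text \<open>The pointwise limit superior inherits the subharmonic inequality, so the maximum
  principle makes it at most 0; as \<open>g\<close> is nonnegative, this is convergence to
  0.\<close>

lemma subharmonic_sequence_tendsto_0: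
  fixes g :: "nat \<Rightarrow> 'a \<Rightarrow> real"
  assumes K: "stochastic_kernel S K"
    and pos: "\<And>m x. x \<in> S \<Longrightarrow> 0 \<le> g m x" and bdd: "\<And>m x. x \<in> S \<Longrightarrow> g m x \<le> b"
    and sub: "\<And>m x. x \<in> S \<Longrightarrow> g (Suc m) x \<le> (\<Sum>y\<in>S. K x y * g m y)"
    and reach: "\<And>x. x \<in> S \<Longrightarrow>
      \<exists>z\<in>S. (x, z) \<in> (kernel_edges S K)\<^sup>* \<and> (\<lambda>m. g m z) \<longlonglongrightarrow> 0"
    and x: "x \<in> S"
  shows "(\<lambda>m. g m x) \<longlonglongrightarrow> 0"
proof -
  have fin: "finite S" and nonneg: "\<And>x y. x \<in> S \<Longrightarrow> y \<in> S \<Longrightarrow> 0 \<le> K x y"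
    and sum1: "\<And>x. x \<in> S \<Longrightarrow> (\<Sum>y\<in>S. K x y) = 1"
    using K by (auto simp: stochastic_kernel_def)
  define U where "U x = {c. \<forall>\<^sub>F m in sequentially. g m x \<le> c}" for x
  \<comment> \<open>\<open>G x\<close> is the limit superior of \<open>g m x\<close>.\<close>
  define G where "G x = Inf (U x)" for x
  have ne: "U x \<noteq> {}" if "x \<in> S" for x
    using bdd[OF that] by (auto simp: U_def intro: always_eventually)
  have bddU: "bdd_below (U x)" if "x \<in> S" for x
  proof (rule bdd_belowI[of _ 0])
    fix c assume "c \<in> U x"
    then obtain m where "g m x \<le> c" by (auto simp: U_def eventually_sequentially)
    then show "0 \<le> c" using pos[OF that, of m] by simp
  qed
  have G_le: "G x \<le> c" if "x \<in> S" "\<forall>\<^sub>F m in sequentially. g m x \<le> c" for x c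
    using that bddU by (auto simp: G_def U_def intro!: cInf_lower)
  have le_G: "\<forall>\<^sub>F m in sequentially. g m x \<le> G x + e" if "x \<in> S" "e > 0" for x e
  proof -
    have "Inf (U x) < G x + e" using that by (simp add: G_def)
    then have "\<exists>c\<in>U x. c < G x + e" by (rule cInf_lessD[OF ne[OF that(1)]])
    then obtain c where "c \<in> U x" "c < G x + e" by blast
    then show ?thesis by (auto simp: U_def elim: eventually_mono)
  qed
  have "G x \<le> 0"
  proof (rule subharmonic_max_principle[OF K _ _ x])
    fix x assume x: "x \<in> S"
    show "G x \<le> (\<Sum>y\<in>S. K x y * G y)"
    proof (rule field_le_epsilon)
      fix e :: real assume e: "e > 0"
      \<comment> \<open>Finiteness of \<open>S\<close> provides one threshold for all
        states.\<close>
      have "\<forall>\<^sub>F m in sequentially. \<forall>y\<in>S. g m y \<le> G y + e"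
        using fin le_G e by (intro eventually_ball_finite) auto
      then have "\<forall>\<^sub>F m in sequentially. g (Suc m) x \<le> (\<Sum>y\<in>S. K x y * G y) + e"
      proof (rule eventually_mono)
        fix m assume *: "\<forall>y\<in>S. g m y \<le> G y + e"
        have "g (Suc m) x \<le> (\<Sum>y\<in>S. K x y * g m y)" using sub x by simp
        also have "\<dots> \<le> (\<Sum>y\<in>S. K x y * (G y + e))"
          using * nonneg x by (intro sum_mono mult_left_mono) auto
        also have "\<dots> = (\<Sum>y\<in>S. K x y * G y) + e"
          using sum1[OF x] by (simp add: distrib_left sum.distrib flip: sum_distrib_right)
        finally show "g (Suc m) x \<le> (\<Sum>y\<in>S. K x y * G y) + e" .
      qed
      then have "\<forall>\<^sub>F m in sequentially. g m x \<le> (\<Sum>y\<in>S. K x y * G y) + e"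
        by (rule eventually_sequentially_Suc[THEN iffD1])
      then show "G x \<le> (\<Sum>y\<in>S. K x y * G y) + e" using x by (rule G_le[rotated])
    qed
    obtain z where z: "z \<in> S" "(x, z) \<in> (kernel_edges S K)\<^sup>*" "(\<lambda>m. g m z) \<longlonglongrightarrow> 0"
      using reach[OF x] by blast
    have "G z \<le> 0 + e" if "e > 0" for e
      using z(1) order_tendstoD(2)[OF z(3) that] by (auto intro!: G_le elim: eventually_mono)
    then have "G z \<le> 0" by (rule field_le_epsilon)
    then show "\<exists>z. (x, z) \<in> (kernel_edges S K)\<^sup>* \<and> G z \<le> 0" using z(2) by blast
  qed
  show ?thesis
  proof (rule order_tendstoI)
    fix a :: real assume "a < 0"
    then show "\<forall>\<^sub>F m in sequentially. a < g m x"
      using pos[OF x] by (intro always_eventually) (auto intro: less_le_trans)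
  next
    fix a :: real assume a: "0 < a"
    have "\<forall>\<^sub>F m in sequentially. g m x \<le> G x + a / 2" using x a by (intro le_G) auto
    then show "\<forall>\<^sub>F m in sequentially. g m x < a"
      by (rule eventually_mono) (use a \<open>G x \<le> 0\<close> in linarith)
  qed
qed

lemma kernel_sequence_bounded:
  fixes h :: "nat \<Rightarrow> 'a \<Rightarrow> real"
  assumes K: "stochastic_kernel S K"
    and h: "\<And>m x. x \<in> S \<Longrightarrow> h (Suc m) x = (\<Sum>y\<in>S. K x y * h m y)"
  obtains b where "\<And>m x. x \<in> S \<Longrightarrow> \<bar>h m x\<bar> \<le> b"
proof -
  have fin: "finite S" and nonneg: "\<And>x y. x \<in> S \<Longrightarrow> y \<in> S \<Longrightarrow> 0 \<le> K x y"
    and sum1: "\<And>x. x \<in> S \<Longrightarrow> (\<Sum>y\<in>S. K x y) = 1"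
    using K by (auto simp: stochastic_kernel_def)
  define b where "b = Max ((\<lambda>x. \<bar>h 0 x\<bar>) ` S)"
  have "\<forall>x\<in>S. \<bar>h m x\<bar> \<le> b" for m
  proof (induction m)
    case 0
    show ?case using fin by (auto simp: b_def)
  next
    case (Suc m)
    show ?case
    proof
      fix x assume x: "x \<in> S"
      have "\<bar>h (Suc m) x\<bar> \<le> (\<Sum>y\<in>S. \<bar>K x y * h m y\<bar>)" unfolding h[OF x] by (rule sum_abs)
      also have "\<dots> \<le> (\<Sum>y\<in>S. K x y * b)"
        using Suc nonneg[OF x] by (intro sum_mono) (auto simp: abs_mult intro!: mult_left_mono)
      also have "\<dots> = b" using sum1[OF x] by (simp flip: sum_distrib_right)
      finally show "\<bar>h (Suc m) x\<bar> \<le> b" .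
    qed
  qed
  then show thesis by (intro that) blast
qed

section \<open>Two independent copies of a chain\<close>

lemma relpow_loop: "(s, s) \<in> R \<Longrightarrow> (s, s) \<in> R ^^ n"
  by (induction n) auto

lemma relpow_pair:
  fixes R :: "'a rel" and R' :: "'b rel"
  assumes "(x, y) \<in> R ^^ n" "(x', y') \<in> R' ^^ n"
  shows "((x, x'), (y, y')) \<in> {((u, u'), (v, v')). (u, v) \<in> R \<and> (u', v') \<in> R'} ^^ n"
  using assms
proof (induction n arbitrary: y y')
  case (Suc n)
  then obtain z z' where "(x, z) \<in> R ^^ n" "(z, y) \<in> R" "(x', z') \<in> R' ^^ n" "(z', y') \<in> R'"
    by auto
  then show ?case using Suc.IH[of z z'] by (auto intro!: relcompI)
qed simp

text \<open>Two independent copies of the chain meet at the looping state, after waiting there for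
  each other.\<close>

lemma irreducible_loop_oscillation_tendsto_0:
  fixes h :: "nat \<Rightarrow> 'a \<Rightarrow> real"
  assumes K: "stochastic_kernel C K"
    and h: "\<And>m x. x \<in> C \<Longrightarrow> h (Suc m) x = (\<Sum>y\<in>C. K x y * h m y)"
    and loop: "s \<in> C" "K s s > 0"
    and reach: "\<And>x. x \<in> C \<Longrightarrow> (x, s) \<in> (kernel_edges C K)\<^sup>*"
    and xy: "x \<in> C" "y \<in> C"
  shows "(\<lambda>m. \<bar>h m x - h m y\<bar>) \<longlonglongrightarrow> 0"
proof -
  have fin: "finite C" and nonneg: "\<And>x y. x \<in> C \<Longrightarrow> y \<in> C \<Longrightarrow> 0 \<le> K x y"
    and sum1: "\<And>x. x \<in> C \<Longrightarrow> (\<Sum>y\<in>C. K x y) = 1"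
    using K by (auto simp: stochastic_kernel_def)
  \<comment> \<open>\<open>K2\<close> moves both coordinates independently; \<open>g\<close>
    compares the values of \<open>h\<close> at the two coordinates and vanishes on the
    diagonal.\<close>
  define K2 where "K2 p q = K (fst p) (fst q) * K (snd p) (snd q)" for p q
  define g where "g m p = \<bar>h m (fst p) - h m (snd p)\<bar>" for m p
  obtain b where b: "\<And>m x. x \<in> C \<Longrightarrow> \<bar>h m x\<bar> \<le> b"
    using kernel_sequence_bounded[where h = h, OF K h] by blast
  \<comment> \<open>As rows sum to 1, averaging a difference over the product kernel gives the
    difference of the separate averages; this makes \<open>g\<close> subharmonic for
    \<open>K2\<close>.\<close>
  have double: "(\<Sum>q\<in>C \<times> C. K u (fst q) * K v (snd q) * (\<phi> (fst q) - \<psi> (snd q))) =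
      (\<Sum>y\<in>C. K u y * \<phi> y) - (\<Sum>y\<in>C. K v y * \<psi> y)" if "u \<in> C" "v \<in> C" for u v \<phi> \<psi>
  proof -
    have "(\<Sum>q\<in>C \<times> C. K u (fst q) * K v (snd q) * (\<phi> (fst q) - \<psi> (snd q))) =
        (\<Sum>y\<in>C. \<Sum>y'\<in>C. (K u y * \<phi> y) * K v y') - (\<Sum>y\<in>C. \<Sum>y'\<in>C. K u y * (K v y' * \<psi> y'))"
      by (simp add: sum.cartesian_product' algebra_simps flip: sum_subtractf)
    also have "\<dots> = (\<Sum>y\<in>C. K u y * \<phi> y) * (\<Sum>y'\<in>C. K v y') -
        (\<Sum>y\<in>C. K u y) * (\<Sum>y'\<in>C. K v y' * \<psi> y')"
      by (simp only: sum_product)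
    finally show ?thesis using that sum1 by simp
  qed
  have K2: "stochastic_kernel (C \<times> C) K2"
    unfolding stochastic_kernel_def
  proof (intro conjI ballI)
    fix p assume p: "p \<in> C \<times> C"
    have "(\<Sum>q\<in>C \<times> C. K2 p q) = (\<Sum>y\<in>C. K (fst p) y) * (\<Sum>y\<in>C. K (snd p) y)"
      by (simp add: K2_def sum.cartesian_product' sum_product)
    then show "(\<Sum>q\<in>C \<times> C. K2 p q) = 1" using sum1 p by auto
  qed (use fin nonneg in \<open>auto simp: K2_def\<close>)
  have "(\<lambda>m. g m (x, y)) \<longlonglongrightarrow> 0"
  proof (rule subharmonic_sequence_tendsto_0[OF K2])
    fix m p assume p: "p \<in> C \<times> C"
    show "0 \<le> g m p" by (simp add: g_def)
    show "g m p \<le> b + b" using b[of "fst p" m] b[of "snd p" m] p by (auto simp: g_def)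
    have "g (Suc m) p = \<bar>\<Sum>q\<in>C \<times> C. K2 p q * (h m (fst q) - h m (snd q))\<bar>"
      using p h by (auto simp: g_def K2_def double)
    also have "\<dots> \<le> (\<Sum>q\<in>C \<times> C. \<bar>K2 p q * (h m (fst q) - h m (snd q))\<bar>)" by (rule sum_abs)
    also have "\<dots> = (\<Sum>q\<in>C \<times> C. K2 p q * g m q)"
      using p nonneg by (intro sum.cong) (auto simp: g_def abs_mult K2_def)
    finally show "g (Suc m) p \<le> (\<Sum>q\<in>C \<times> C. K2 p q * g m q)" .
  next
    fix p assume "p \<in> C \<times> C"
    then obtain u v where p: "p = (u, v)" "u \<in> C" "v \<in> C" by blast
    let ?E = "kernel_edges C K"
    obtain i j where ij: "(u, s) \<in> ?E ^^ i" "(v, s) \<in> ?E ^^ j"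
      using reach[OF p(2)] reach[OF p(3)] by (meson rtrancl_imp_relpow)
    have "(s, s) \<in> ?E" using loop by (simp add: kernel_edges_def)
    then have wait: "(s, s) \<in> ?E ^^ n" for n by (rule relpow_loop)
    \<comment> \<open>The first copy waits \<open>j\<close> steps at \<open>s\<close> and the second
      \<open>i\<close> steps, so both paths get the same length.\<close>
    have "(u, s) \<in> ?E ^^ (i + j)" using ij(1) wait[of j] by (auto simp: relpow_add)
    moreover have "(v, s) \<in> ?E ^^ (i + j)"
      using ij(2) wait[of i] by (subst add.commute) (auto simp: relpow_add)
    ultimately have "(p, (s, s)) \<in> {((u, u'), (v, v')). (u, v) \<in> ?E \<and> (u', v') \<in> ?E} ^^ (i + j)"
      unfolding p by (rule relpow_pair)
    then have "(p, (s, s)) \<in> {((u, u'), (v, v')). (u, v) \<in> ?E \<and> (u', v') \<in> ?E}\<^sup>*"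
      by (rule relpow_imp_rtrancl)
    moreover have "{((u, u'), (v, v')). (u, v) \<in> ?E \<and> (u', v') \<in> ?E} \<subseteq> kernel_edges (C \<times> C) K2"
      by (auto simp: kernel_edges_def K2_def)
    ultimately have "(p, (s, s)) \<in> (kernel_edges (C \<times> C) K2)\<^sup>*" using rtrancl_mono by blast
    moreover have "(\<lambda>m. g m (s, s)) \<longlonglongrightarrow> 0" by (simp add: g_def)
    ultimately show "\<exists>z\<in>C \<times> C. (p, z) \<in> (kernel_edges (C \<times> C) K2)\<^sup>* \<and> (\<lambda>m. g m z) \<longlonglongrightarrow> 0"
      using loop(1) by blast
  qed (use xy in auto)
  then show ?thesis by (simp add: g_def)
qed

section \<open>Recurrent states and vanishing increments\<close>

lemma recurrent_point_reachable:
  fixes R :: "'a rel"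
  assumes fin: "finite (R\<^sup>* `` {x})"
  obtains z where "(x, z) \<in> R\<^sup>*" "\<And>y. (z, y) \<in> R\<^sup>* \<Longrightarrow> (y, z) \<in> R\<^sup>*"
proof -
  \<comment> \<open>\<open>z\<close> has the smallest reachable set. A point reachable from
    \<open>z\<close> has a reachable set inside that one and no smaller, hence equal, so it leads
    back to \<open>z\<close>.\<close>
  obtain z where z: "(x, z) \<in> R\<^sup>*"
    and least: "\<And>y. (x, y) \<in> R\<^sup>* \<Longrightarrow> card (R\<^sup>* `` {z}) \<le> card (R\<^sup>* `` {y})"
    using ex_has_least_nat[of "\<lambda>z. (x, z) \<in> R\<^sup>*" x "\<lambda>z. card (R\<^sup>* `` {z})"] by blast
  show thesis
  proof (rule that[OF z])
    fix y assume y: "(z, y) \<in> R\<^sup>*"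
    have "R\<^sup>* `` {z} \<subseteq> R\<^sup>* `` {x}" using z by (auto intro: rtrancl_trans)
    then have "finite (R\<^sup>* `` {z})" using fin finite_subset by blast
    moreover have "R\<^sup>* `` {y} \<subseteq> R\<^sup>* `` {z}" using y by (auto intro: rtrancl_trans)
    moreover have "card (R\<^sup>* `` {z}) \<le> card (R\<^sup>* `` {y})"
      using z y by (intro least) (rule rtrancl_trans)
    ultimately have "R\<^sup>* `` {y} = R\<^sup>* `` {z}" by (rule card_seteq)
    then show "(y, z) \<in> R\<^sup>*" by blast
  qed
qed

text \<open>At a looping state of a closed class, the increment is an average of differences within
  the class, which vanish in the limit. Absolute increments are subharmonic and every state reaches
  such a looping state, so they vanish everywhere.\<close>

lemma kernel_increments_tendsto_0:
  fixes h :: "nat \<Rightarrow> 'a \<Rightarrow> real"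
  assumes K: "stochastic_kernel S K"
    and h: "\<And>m x. x \<in> S \<Longrightarrow> h (Suc m) x = (\<Sum>y\<in>S. K x y * h m y)"
    and loops: "\<And>x. x \<in> S \<Longrightarrow> \<exists>s. (x, s) \<in> (kernel_edges S K)\<^sup>* \<and> K s s > 0"
    and x: "x \<in> S"
  shows "(\<lambda>m. h (Suc m) x - h m x) \<longlonglongrightarrow> 0"
proof -
  let ?E = "kernel_edges S K"
  have fin: "finite S" and nonneg: "\<And>x y. x \<in> S \<Longrightarrow> y \<in> S \<Longrightarrow> 0 \<le> K x y"
    and sum1: "\<And>x. x \<in> S \<Longrightarrow> (\<Sum>y\<in>S. K x y) = 1"
    using K by (auto simp: stochastic_kernel_def)
  obtain b where b: "\<And>m x. x \<in> S \<Longrightarrow> \<bar>h m x\<bar> \<le> b"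
    using kernel_sequence_bounded[where h = h, OF K h] by blast
  have in_S: "y \<in> S" if "(x, y) \<in> ?E\<^sup>*" "x \<in> S" for x y
    using that by (induction rule: rtrancl_induct) (auto simp: kernel_edges_def)
  have recurrent: "(\<lambda>m. \<bar>h (Suc m) s - h m s\<bar>) \<longlonglongrightarrow> 0"
    if s: "s \<in> S" "K s s > 0" "\<And>y. (s, y) \<in> ?E\<^sup>* \<Longrightarrow> (y, s) \<in> ?E\<^sup>*" for s
  proof -
    \<comment> \<open>\<open>C\<close> is the communicating class of \<open>s\<close>; it is closed,
      so the kernel restricted to it stays stochastic.\<close>
    define C where "C = ?E\<^sup>* `` {s}"
    have CS: "C \<subseteq> S" using in_S s(1) by (auto simp: C_def)
    have sC: "s \<in> C" by (simp add: C_def)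
    have closed: "w \<in> C" if "(y, w) \<in> ?E" "y \<in> C" for y w
      using that by (auto simp: C_def intro: rtrancl_into_rtrancl)
    have "K y w = 0" if "y \<in> C" "w \<in> S - C" for y w
      using closed[of y w] nonneg[of y w] that CS by (force simp: kernel_edges_def)
    then have restrict: "(\<Sum>w\<in>S. K y w * f w) = (\<Sum>w\<in>C. K y w * f w)" if "y \<in> C" for y f
      using that fin CS by (intro sum.mono_neutral_right) auto
    have KC: "stochastic_kernel C K"
      unfolding stochastic_kernel_def
    proof (intro conjI ballI)
      show "finite C" using CS fin by (rule finite_subset)
      show "(\<Sum>w\<in>C. K y w) = 1" if "y \<in> C" for y
        using restrict[OF that, of "\<lambda>_. 1"] sum1[of y] that CS by auto
    qed (use nonneg CS in auto)
    have hC: "h (Suc m) y = (\<Sum>w\<in>C. K y w * h m w)" if "y \<in> C" for m y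
      using h[of y m] restrict[OF that] that CS by auto
    have path: "(y, s) \<in> (kernel_edges C K)\<^sup>*" if "y \<in> C" for y
    proof -
      have "(y, s) \<in> ?E\<^sup>*" using that s(3) by (auto simp: C_def)
      then show ?thesis using that
      proof (induction rule: converse_rtrancl_induct)
        case (step u v)
        then have "(u, v) \<in> kernel_edges C K" using closed by (auto simp: kernel_edges_def)
        then show ?case using step closed by (meson converse_rtrancl_into_rtrancl)
      qed simp
    qed
    have osc: "(\<lambda>m. \<bar>h m y - h m s\<bar>) \<longlonglongrightarrow> 0" if "y \<in> C" for y
      using irreducible_loop_oscillation_tendsto_0[where h = h, OF KC hC sC s(2) path that sC] .
    have "(\<lambda>m. \<Sum>y\<in>C. K s y * \<bar>h m y - h m s\<bar>) \<longlonglongrightarrow> (\<Sum>y\<in>C. K s y * 0)"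
      using osc by (intro tendsto_intros)
    then have lim: "(\<lambda>m. \<Sum>y\<in>C. K s y * \<bar>h m y - h m s\<bar>) \<longlonglongrightarrow> 0" by simp
    show ?thesis
    proof (rule tendsto_sandwich[OF _ _ tendsto_const lim])
      have "\<bar>h (Suc m) s - h m s\<bar> \<le> (\<Sum>y\<in>C. K s y * \<bar>h m y - h m s\<bar>)" for m
      proof -
        \<comment> \<open>Row sum 1 turns the increment in time into an average of differences
          between states at the same time \<open>m\<close>.\<close>
        have "h (Suc m) s - h m s = (\<Sum>y\<in>C. K s y * (h m y - h m s))"
          using hC[OF sC] KC sC by (simp add: right_diff_distrib sum_subtractf
              stochastic_kernel_def flip: sum_distrib_right)
        also have "\<bar>\<dots>\<bar> \<le> (\<Sum>y\<in>C. \<bar>K s y * (h m y - h m s)\<bar>)" by (rule sum_abs)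
        also have "\<dots> = (\<Sum>y\<in>C. K s y * \<bar>h m y - h m s\<bar>)"
          using nonneg CS s(1) by (intro sum.cong) (auto simp: abs_mult)
        finally show ?thesis .
      qed
      then show "\<forall>\<^sub>F m in sequentially. \<bar>h (Suc m) s - h m s\<bar> \<le> (\<Sum>y\<in>C. K s y * \<bar>h m y - h m s\<bar>)"
        by simp
    qed simp
  qed
  have "(\<lambda>m. \<bar>h (Suc m) x - h m x\<bar>) \<longlonglongrightarrow> 0"
  proof (rule subharmonic_sequence_tendsto_0[OF K _ _ _ _ x])
    fix m y assume y: "y \<in> S"
    show "0 \<le> \<bar>h (Suc m) y - h m y\<bar>" by simp
    show "\<bar>h (Suc m) y - h m y\<bar> \<le> b + b" using b[OF y, of m] b[OF y, of "Suc m"] by linarith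
    have "h (Suc (Suc m)) y - h (Suc m) y = (\<Sum>w\<in>S. K y w * (h (Suc m) w - h m w))"
      using h[OF y] by (simp add: right_diff_distrib sum_subtractf)
    also have "\<bar>\<dots>\<bar> \<le> (\<Sum>w\<in>S. \<bar>K y w * (h (Suc m) w - h m w)\<bar>)" by (rule sum_abs)
    also have "\<dots> = (\<Sum>w\<in>S. K y w * \<bar>h (Suc m) w - h m w\<bar>)"
      using nonneg y by (intro sum.cong) (auto simp: abs_mult)
    finally show "\<bar>h (Suc (Suc m)) y - h (Suc m) y\<bar> \<le> (\<Sum>w\<in>S. K y w * \<bar>h (Suc m) w - h m w\<bar>)" .
  next
    fix y assume y: "y \<in> S"
    have "finite (?E\<^sup>* `` {y})"
      using in_S y by (intro finite_subset[OF _ fin]) auto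
    then obtain z where z: "(y, z) \<in> ?E\<^sup>*" "\<And>w. (z, w) \<in> ?E\<^sup>* \<Longrightarrow> (w, z) \<in> ?E\<^sup>*"
      by (rule recurrent_point_reachable) blast
    \<comment> \<open>\<open>z\<close> lies in a closed class, so a loop \<open>s\<close> reached
      from it lies in the same class and is recurrent too.\<close>
    obtain s where s: "(z, s) \<in> ?E\<^sup>*" "K s s > 0" using loops[OF in_S[OF z(1) y]] by blast
    have ys: "(y, s) \<in> ?E\<^sup>*" using z(1) s(1) by (rule rtrancl_trans)
    have "(\<lambda>m. \<bar>h (Suc m) s - h m s\<bar>) \<longlonglongrightarrow> 0"
    proof (rule recurrent)
      show "s \<in> S" using in_S[OF ys y] .
      show "K s s > 0" by fact
      show "(w, s) \<in> ?E\<^sup>*" if "(s, w) \<in> ?E\<^sup>*" for w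
        using z(2)[OF rtrancl_trans[OF s(1) that]] s(1) by (rule rtrancl_trans)
    qed
    then show "\<exists>z\<in>S. (y, z) \<in> ?E\<^sup>* \<and> (\<lambda>m. \<bar>h (Suc m) z - h m z\<bar>) \<longlonglongrightarrow> 0"
      using in_S[OF ys y] ys by blast
  qed
  then show ?thesis by (simp add: tendsto_rabs_zero_iff)
qed

subsection \<open>Unary automata\<close>

lemma pow_mat_add:
  assumes "A \<in> carrier_mat d d"
  shows "A ^\<^sub>m (m + n) = A ^\<^sub>m m * A ^\<^sub>m n"
proof (induction n)
  case 0
  show ?case using assms by simp
next
  case (Suc n)
  then show ?case using assms by (simp add: assoc_mult_mat[of _ d d _ d _ d])
qed

lemma index_mult_mat_sum:
  assumes "A \<in> carrier_mat d d" "B \<in> carrier_mat d d" "i < d" "j < d"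
  shows "(A * B) $$ (i, j) = (\<Sum>l<d. A $$ (i, l) * B $$ (l, j))"
  using assms by (simp add: scalar_prod_def atLeast0LessThan)

lemma column_stochastic_mat_iff:
  "column_stochastic_mat d A \<longleftrightarrow> A \<in> carrier_mat d d \<and>
     (\<forall>i<d. \<forall>j<d. 0 \<le> A $$ (i, j)) \<and> (\<forall>j<d. (\<Sum>i<d. A $$ (i, j)) = 1)"
  by (auto simp: column_stochastic_mat_def stochastic_vec_def)

lemma column_stochastic_mat_pow:
  assumes "column_stochastic_mat d A"
  shows "column_stochastic_mat d (A ^\<^sub>m n)"
proof (induction n)
  case 0
  have "A \<in> carrier_mat d d" using assms by (simp add: column_stochastic_mat_iff)
  then show ?case by (auto simp: column_stochastic_mat_iff)
next
  case (Suc n)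
  have A: "A \<in> carrier_mat d d" and A0: "\<And>i j. i < d \<Longrightarrow> j < d \<Longrightarrow> 0 \<le> A $$ (i, j)"
    and A1: "\<And>j. j < d \<Longrightarrow> (\<Sum>i<d. A $$ (i, j)) = 1"
    using assms by (auto simp: column_stochastic_mat_iff)
  let ?P = "A ^\<^sub>m n"
  have P: "?P \<in> carrier_mat d d" and P0: "\<And>i j. i < d \<Longrightarrow> j < d \<Longrightarrow> 0 \<le> ?P $$ (i, j)"
    and P1: "\<And>j. j < d \<Longrightarrow> (\<Sum>i<d. ?P $$ (i, j)) = 1"
    using Suc by (auto simp: column_stochastic_mat_iff)
  have idx: "(A ^\<^sub>m Suc n) $$ (i, j) = (\<Sum>l<d. ?P $$ (i, l) * A $$ (l, j))" if "i < d" "j < d" for i j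
    using index_mult_mat_sum[OF P A that] by simp
  have "(\<Sum>i<d. (A ^\<^sub>m Suc n) $$ (i, j)) = 1" if j: "j < d" for j
  proof -
    have "(\<Sum>i<d. (A ^\<^sub>m Suc n) $$ (i, j)) = (\<Sum>i<d. \<Sum>l<d. ?P $$ (i, l) * A $$ (l, j))"
      using idx j by (intro sum.cong) auto
    also have "\<dots> = (\<Sum>l<d. (\<Sum>i<d. ?P $$ (i, l)) * A $$ (l, j))"
      by (subst sum.swap) (simp add: sum_distrib_right)
    also have "\<dots> = 1" using P1 A1[OF j] by simp
    finally show ?thesis .
  qed
  moreover have "0 \<le> (A ^\<^sub>m Suc n) $$ (i, j)" if "i < d" "j < d" for i j
    unfolding idx[OF that] using A0 P0 that by (intro sum_nonneg mult_nonneg_nonneg) auto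
  moreover have "A ^\<^sub>m Suc n \<in> carrier_mat d d" by (rule pow_carrier_mat[OF A])
  ultimately show ?case unfolding column_stochastic_mat_iff by blast
qed

text \<open>The product of the entries along the path of \<open>f\<close> is one of the nonnegative
  terms in the expansion of this entry of the power.\<close>

lemma pow_mat_pos_along_map:
  assumes A: "column_stochastic_mat d A"
    and f: "\<And>j. j < d \<Longrightarrow> f j < d \<and> A $$ (f j, j) > 0"
    and j: "j < d"
  shows "(f ^^ n) j < d \<and> (A ^\<^sub>m n) $$ ((f ^^ n) j, j) > 0"
  using j
proof (induction n arbitrary: j)
  case 0
  then show ?case using A by (auto simp: column_stochastic_mat_iff)
next
  case (Suc n)
  have nonneg: "0 \<le> B $$ (i, l)" if "column_stochastic_mat d B" "i < d" "l < d" for B i l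
    using that by (simp add: column_stochastic_mat_iff)
  have fj: "f j < d" "A $$ (f j, j) > 0" using f Suc.prems by auto
  let ?i = "(f ^^ n) (f j)"
  have i: "?i < d" "(A ^\<^sub>m n) $$ (?i, f j) > 0" using Suc.IH[OF fj(1)] by auto
  have car: "A \<in> carrier_mat d d" using A by (simp add: column_stochastic_mat_iff)
  have "0 < (A ^\<^sub>m n) $$ (?i, f j) * A $$ (f j, j)" using fj i by simp
  also have "\<dots> \<le> (\<Sum>l<d. (A ^\<^sub>m n) $$ (?i, l) * A $$ (l, j))"
  proof (rule member_le_sum)
    fix l assume "l \<in> {..<d} - {f j}"
    then show "0 \<le> (A ^\<^sub>m n) $$ (?i, l) * A $$ (l, j)"
      using nonneg[OF A] nonneg[OF column_stochastic_mat_pow[OF A]] i(1) Suc.prems by simp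
  qed (use fj in simp_all)
  also have "\<dots> = (A ^\<^sub>m Suc n) $$ (?i, j)"
    using index_mult_mat_sum[OF pow_carrier_mat[OF car] car i(1) Suc.prems] by simp
  finally show ?case using i by (simp only: funpow_Suc_right o_apply)
qed

lemma final_vec_replicate:
  assumes A: "transition_mat M a \<in> carrier_mat d d" and v: "initial_vec M \<in> carrier_vec d"
  shows "final_vec M (replicate m a) = transition_mat M a ^\<^sub>m m *\<^sub>v initial_vec M"
proof -
  have "foldl (\<lambda>v \<sigma>. transition_mat M \<sigma> *\<^sub>v v) v (replicate m a) = transition_mat M a ^\<^sub>m m *\<^sub>v v"
    if "v \<in> carrier_vec d" for v
    using that
  proof (induction m arbitrary: v)
    case (Suc m)
    then show ?case
      using A by (simp add: assoc_mult_mat_vec[OF pow_carrier_mat[OF A] A])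
  qed (use A in simp)
  then show ?thesis using v by (simp add: final_vec_def)
qed

text \<open>The chain making \<open>L\<close> steps at once is studied, with \<open>L\<close> taken
  from the cycles of a map \<open>f\<close> that picks a successor of positive probability.
  Applications of \<open>f ^^ L\<close> follow edges of this chain and arrive at a fixed point,
  which is a loop.\<close>

lemma unary_pfa_accept_prob_asymptotics:
  assumes M: "is_pfa M" and a: "a \<in> alphabet M"
  obtains L where "L > 0"
    and "(\<lambda>m. accept_prob M (replicate (L * Suc m) a) - accept_prob M (replicate (L * m) a)) \<longlonglongrightarrow> 0"
    and "\<And>D. finite D \<Longrightarrow> (\<And>p. p \<in> D \<Longrightarrow> prime p \<and> p dvd L) \<Longrightarrow> \<Sum>D \<le> num_states M"
proof -
  define d where "d = num_states M"
  define A where "A = transition_mat M a"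
  define v where "v = initial_vec M"
  have A: "column_stochastic_mat d A" and v: "stochastic_vec d v" and acc: "accepting_states M \<subseteq> {..<d}"
    using M a by (auto simp: is_pfa_def d_def A_def v_def)
  have car: "A \<in> carrier_mat d d" using A by (simp add: column_stochastic_mat_iff)
  have "\<exists>i. i < d \<and> A $$ (i, j) > 0" if "j < d" for j
  proof (rule ccontr)
    assume "\<not> ?thesis"
    then have "(\<Sum>i<d. A $$ (i, j)) \<le> 0" by (intro sum_nonpos) (meson lessThan_iff not_less)
    then show False using A that by (auto simp: column_stochastic_mat_iff)
  qed
  then obtain f where f: "\<And>j. j < d \<Longrightarrow> f j < d \<and> A $$ (f j, j) > 0" by metis
  obtain L where L: "L > 0"
    and periodic: "\<And>x. x \<in> {..<d} \<Longrightarrow> \<exists>n. (f ^^ L) ((f ^^ (L * n)) x) = (f ^^ (L * n)) x"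
    and primes: "\<And>D. finite D \<Longrightarrow> (\<And>p. p \<in> D \<Longrightarrow> prime p \<and> p dvd L) \<Longrightarrow> \<Sum>D \<le> card {..<d}"
    using finite_self_map_cycles[of "{..<d}" f] f by (metis finite_lessThan lessThan_iff)
  define K where "K j i = (A ^\<^sub>m L) $$ (i, j)" for i j
  have K: "stochastic_kernel {..<d} K"
    using column_stochastic_mat_pow[OF A, of L]
    by (auto simp: stochastic_kernel_def K_def column_stochastic_mat_iff)
  \<comment> \<open>\<open>h m j\<close> is the probability of acceptance after \<open>L * m\<close>
    steps started in state \<open>j\<close>.\<close>
  define h where "h m j = (\<Sum>i\<in>accepting_states M. (A ^\<^sub>m (L * m)) $$ (i, j))" for m j
  have h: "h (Suc m) j = (\<Sum>l\<in>{..<d}. K j l * h m l)" if "j \<in> {..<d}" for m j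
  proof -
    \<comment> \<open>The factor on the right acts first, so the initial \<open>L\<close> steps are
      split off; this gives the backward recursion for \<open>h\<close>.\<close>
    have "A ^\<^sub>m (L * Suc m) = A ^\<^sub>m (L * m) * A ^\<^sub>m L"
      using pow_mat_add[OF car, of "L * m" L] by (simp add: add.commute)
    then have "h (Suc m) j = (\<Sum>i\<in>accepting_states M. \<Sum>l<d. (A ^\<^sub>m (L * m)) $$ (i, l) * K j l)"
      unfolding h_def K_def using acc that car
      by (intro sum.cong) (auto simp: index_mult_mat_sum[of _ d] simp del: index_mult_mat)
    also have "\<dots> = (\<Sum>l<d. K j l * h m l)"
      unfolding h_def by (subst sum.swap) (simp add: sum_distrib_left mult.commute)
    finally show ?thesis .
  qed
  have loops: "\<exists>s. (x, s) \<in> (kernel_edges {..<d} K)\<^sup>* \<and> K s s > 0" if x: "x \<in> {..<d}" for x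
  proof -
    have edge: "(y, (f ^^ L) y) \<in> kernel_edges {..<d} K" if "y < d" for y
      using pow_mat_pos_along_map[OF A f that, of L] that by (auto simp: kernel_edges_def K_def)
    have path: "(x, (f ^^ (L * n)) x) \<in> (kernel_edges {..<d} K)\<^sup>*" for n
    proof (induction n)
      case (Suc n)
      have "(f ^^ (L * n)) x < d" using pow_mat_pos_along_map[OF A f] x by blast
      then show ?case using Suc edge by (auto simp: funpow_add intro: rtrancl_into_rtrancl)
    qed simp
    obtain n where "(f ^^ L) ((f ^^ (L * n)) x) = (f ^^ (L * n)) x" using periodic[OF x] by blast
    moreover have "(f ^^ (L * n)) x < d" using pow_mat_pos_along_map[OF A f] x by blast
    ultimately have "K ((f ^^ (L * n)) x) ((f ^^ (L * n)) x) > 0"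
      using edge by (force simp: kernel_edges_def)
    then show ?thesis using path by blast
  qed
  have acc_h: "accept_prob M (replicate (L * m) a) = (\<Sum>j<d. v $ j * h m j)" for m
  proof -
    have vd: "v \<in> carrier_vec d" using v by (simp add: stochastic_vec_def)
    have "accept_prob M (replicate (L * m) a) = (\<Sum>i\<in>accepting_states M. (A ^\<^sub>m (L * m) *\<^sub>v v) $ i)"
      using final_vec_replicate[of M a d] car vd by (simp add: accept_prob_def A_def v_def)
    also have "\<dots> = (\<Sum>i\<in>accepting_states M. \<Sum>j<d. (A ^\<^sub>m (L * m)) $$ (i, j) * v $ j)"
      using acc car vd by (intro sum.cong) (auto simp: scalar_prod_def atLeast0LessThan)
    also have "\<dots> = (\<Sum>j<d. v $ j * h m j)"
      unfolding h_def by (subst sum.swap) (simp add: sum_distrib_left mult.commute)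
    finally show ?thesis .
  qed
  have "(\<lambda>m. h (Suc m) j - h m j) \<longlonglongrightarrow> 0" if "j \<in> {..<d}" for j
    using kernel_increments_tendsto_0[where h = h, OF K h loops that] .
  then have "(\<lambda>m. \<Sum>j<d. v $ j * (h (Suc m) j - h m j)) \<longlonglongrightarrow> (\<Sum>j<d. v $ j * 0)"
    by (intro tendsto_intros)
  then have "(\<lambda>m. accept_prob M (replicate (L * Suc m) a) - accept_prob M (replicate (L * m) a)) \<longlonglongrightarrow> 0"
    unfolding acc_h by (simp add: right_diff_distrib sum_subtractf)
  then show thesis using that[OF L] primes by (simp add: d_def)
qed

section \<open>No-instances among the multiples of the period\<close>

lemma residue_in_no_zone:
  fixes p :: nat
  assumes "p \<ge> 3"
  obtains r where "r < p" "real p / 8 \<le> real r" "real r \<le> 3 * real p / 8"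
proof -
  \<comment> \<open>\<open>r\<close> is \<open>p / 8\<close> rounded up. For \<open>p = 2\<close>
    the zones contain no integer, hence the assumption \<open>p >= 3\<close>.\<close>
  define r where "r = (p + 7) div 8"
  have r: "8 * r \<le> p + 7" "p + 7 < 8 * r + 8"
    using div_mult_mod_eq[of "p + 7" 8] mod_less_divisor[of 8 "p + 7"] by (simp_all add: r_def)
  have "8 * r \<le> 3 * p"
  \<comment> \<open>The estimate \<open>8 * r <= p + 7 <= 3 * p\<close> starts at
    \<open>p = 4\<close>; for \<open>p = 3\<close> the value is \<open>r = 1\<close>.\<close>
  proof (cases "p = 3")
    case False
    then show ?thesis using assms r by linarith
  qed (simp add: r_def)
  moreover have "p \<le> 8 * r" "r < p" using assms r by linarith+
  ultimately show thesis using that[of r] by linarith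
qed

lemma finite_prime_block: "finite (prime_block k n)"
  by (simp add: prime_block_def)

lemma prime_of_prime_block: "p \<in> prime_block k n \<Longrightarrow> prime p"
  by (auto simp: prime_block_def prime_nth_prime)

lemma card_prime_block: "n \<ge> 1 \<Longrightarrow> card (prime_block k n) = k"
  unfolding prime_block_def by (subst card_image) (auto intro: inj_on_subset[OF inj_on_nth_prime])

lemma prime_block_ge_3: "n \<ge> 2 \<Longrightarrow> p \<in> prime_block k n \<Longrightarrow> p \<ge> 3"
  by (auto simp: prime_block_def Suc_le_eq numeral_3_eq_3 intro: le_less_trans[OF _ nth_prime_gt])

text \<open>The Chinese remainder theorem gives \<open>y = L * q\<close> with a no-zone residue
  modulo every block prime not dividing \<open>L\<close>, thus modulo at least
  \<open>2 * k / 3\<close> primes. Adding multiples of the block product keeps the residues, so one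
  offset \<open>q\<close> serves all \<open>i\<close>.\<close>

lemma exists_multiple_in_no_zone:
  assumes n: "n \<ge> 2" and L: "L > 0"
    and few: "real (card {p \<in> prime_block k n. p dvd L}) \<le> real k / 3"
  obtains q where "\<And>i. replicate (L * (i * \<Prod>(prime_block k n) + q)) a \<in> L_no a k n"
proof -
  let ?P = "prime_block k n"
  define E where "E = {p \<in> ?P. \<not> p dvd L}"
  have finE: "finite E" using finite_prime_block by (simp add: E_def)
  have primeE: "prime p" if "p \<in> E" for p using that prime_of_prime_block by (auto simp: E_def)
  have "\<exists>r. r < p \<and> real p / 8 \<le> real r \<and> real r \<le> 3 * real p / 8" if "p \<in> ?P" for p
    using residue_in_no_zone[OF prime_block_ge_3[OF n that]] by blast
  then obtain r where r: "\<And>p. p \<in> ?P \<Longrightarrow> r p < p \<and> real p / 8 \<le> real (r p) \<and> real (r p) \<le> 3 * real p / 8"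
    by metis
  have "\<exists>x. \<forall>p\<in>E. [x = r p] (mod p)"
    using finE by (rule chinese_remainder_nat) (simp add: primeE primes_coprime)
  then obtain x where x: "\<And>p. p \<in> E \<Longrightarrow> [x = r p] (mod p)" by blast
  have "coprime (\<Prod>E) L"
    using primeE by (intro prod_coprime_left) (auto simp: E_def prime_imp_coprime_nat)
  then obtain y where y: "[y = x] (mod \<Prod>E)" "[y = 0] (mod L)"
    using binary_chinese_remainder_nat by blast
  then obtain q where q: "y = L * q" by (auto simp: cong_0_iff)
  show thesis
  proof
    fix i
    let ?m = "L * (i * \<Prod>?P + q)"
    have "real (?m mod p) \<in> {real p / 8..3 * real p / 8}" if p: "p \<in> E" for p
    proof -
      have pP: "p \<in> ?P" using p by (simp add: E_def)
      have "[?m = y] (mod p)"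
      proof -
        have "p dvd L * (i * \<Prod>?P)" using pP finite_prime_block by (intro dvd_mult) (rule dvd_prodI)
        then have "[L * (i * \<Prod>?P) + y = 0 + y] (mod p)"
          by (intro cong_add cong_refl) (simp add: cong_0_iff)
        then show ?thesis by (simp only: q distrib_left add_0)
      qed
      also have "[y = x] (mod p)"
        using y(1) dvd_prodI[OF finE p, of "\<lambda>p. p"] by (rule cong_dvd_modulus_nat)
      also have "[x = r p] (mod p)" by (rule x[OF p])
      finally have "?m mod p = r p" using r[OF pP] by (simp add: cong_def)
      then show ?thesis using r[OF pP] by simp
    qed
    then have "E \<subseteq> {p \<in> ?P. real (?m mod p) \<in>
        {real p / 8..3 * real p / 8} \<union> {5 * real p / 8..7 * real p / 8}}" (is "_ \<subseteq> ?Z")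
      unfolding E_def by blast
    then have "card E \<le> card ?Z" using finite_prime_block by (intro card_mono) auto
    moreover have "card E + card {p \<in> ?P. p dvd L} = k"
    proof -
      have "?P = E \<union> {p \<in> ?P. p dvd L}" by (auto simp: E_def)
      moreover have "E \<inter> {p \<in> ?P. p dvd L} = {}" by (auto simp: E_def)
      ultimately show ?thesis
        using card_Un_disjoint[of E "{p \<in> ?P. p dvd L}"] finE finite_prime_block
          card_prime_block[of n k] n by simp
    qed
    ultimately have "real (card ?Z) \<ge> 2 * real k / 3" using few by linarith
    then show "replicate ?m a \<in> L_no a k n" unfolding L_no_def by blast
  qed
qed

text \<open>Telescoping: the difference is a sum of \<open>q\<close> increments, and
  \<open>q\<close> stays fixed as \<open>m\<close> grows.\<close>

lemma increments_tendsto_0_shift: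
  fixes F :: "nat \<Rightarrow> real"
  assumes "(\<lambda>m. F (Suc m) - F m) \<longlonglongrightarrow> 0"
  shows "(\<lambda>m. F (m + q) - F m) \<longlonglongrightarrow> 0"
proof (induction q)
  case (Suc q)
  have "(\<lambda>m. (F (Suc (m + q)) - F (m + q)) + (F (m + q) - F m)) \<longlonglongrightarrow> 0 + 0"
    using LIMSEQ_ignore_initial_segment[OF assms, of q] Suc by (intro tendsto_add) auto
  then show ?case by simp
qed simp

text \<open>Otherwise \<open>F\<close> drops by at least \<open>1 - 2 * \<epsilon>\<close> from
  \<open>i * N\<close> to \<open>i * N + q\<close> for every \<open>i\<close>, while vanishing
  increments force this difference to 0 along the subsequence \<open>i * N\<close>.\<close>

lemma many_block_primes_dvd_period:
  assumes n: "n \<ge> 2" and e: "\<epsilon> < 1 / 2" and sol: "solves_with_error M (L_problem a k n) \<epsilon>"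
    and L: "L > 0"
    and lim: "(\<lambda>m. accept_prob M (replicate (L * Suc m) a) - accept_prob M (replicate (L * m) a)) \<longlonglongrightarrow> 0"
  shows "real (card {p \<in> prime_block k n. p dvd L}) \<ge> real k / 3"
proof (rule ccontr)
  assume "\<not> ?thesis"
  then have "real (card {p \<in> prime_block k n. p dvd L}) \<le> real k / 3" by linarith
  then obtain q where q: "\<And>i. replicate (L * (i * \<Prod>(prime_block k n) + q)) a \<in> L_no a k n"
    by (rule exists_multiple_in_no_zone[where a = a, OF n L]) blast
  define N where "N = \<Prod>(prime_block k n)"
  define F where "F m = accept_prob M (replicate (L * m) a)" for m
  have N: "N > 0" using prime_of_prime_block prime_gt_0_nat by (auto simp: N_def intro!: prod_pos)
  have yes: "F (i * N) \<ge> 1 - \<epsilon>" for i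
  proof -
    have "[L * (i * N) = 0] (mod N)" by (simp add: cong_0_iff)
    then have "replicate (L * (i * N)) a \<in> L_yes a k n" by (auto simp: L_yes_def N_def)
    then show ?thesis using sol by (auto simp: solves_with_error_def L_problem_def F_def)
  qed
  have no: "F (i * N + q) \<le> \<epsilon>" for i
    using q[of i] sol
    by (auto simp: solves_with_error_def L_problem_def reject_prob_def F_def N_def)
  have "strict_mono (\<lambda>i. i * N)" using N by (auto intro: strict_monoI)
  moreover have "(\<lambda>m. F (m + q) - F m) \<longlonglongrightarrow> 0"
    using lim unfolding F_def by (rule increments_tendsto_0_shift)
  ultimately have "(\<lambda>i. F (i * N + q) - F (i * N)) \<longlonglongrightarrow> 0"
    using LIMSEQ_subseq_LIMSEQ by (fastforce simp: o_def)
  moreover have "F (i * N + q) - F (i * N) \<le> 2 * \<epsilon> - 1" for i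
    using yes[of i] no[of i] by linarith
  ultimately have "0 \<le> 2 * \<epsilon> - 1" by (intro LIMSEQ_le_const2) auto
  then show False using e by simp
qed

section \<open>The bound on the number of states\<close>

lemma num_states_lower_bound:
  assumes n: "n \<ge> 2" and e: "\<epsilon> < 1 / 2" and M: "is_pfa M"
    and sol: "solves_with_error M (L_problem a k n) \<epsilon>"
  shows "1 / (72 * ln 8) * (real k * (real n + real k) * ln (real n)) \<le> real (num_states M)"
proof -
  let ?N = "\<Prod>(prime_block k n)"
  \<comment> \<open>A nonempty yes-instance has to be a word over the alphabet, which therefore
    contains \<open>a\<close>.\<close>
  have "replicate ?N a \<in> L_yes a k n" by (auto simp: L_yes_def cong_0_iff)
  then have "replicate ?N a \<in> lists (alphabet M)"
    using sol by (auto simp: solves_with_error_def L_problem_def)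
  moreover have "?N > 0" using prime_of_prime_block prime_gt_0_nat by (auto intro!: prod_pos)
  ultimately have "a \<in> alphabet M" by (auto simp: in_lists_conv_set)
  then obtain L where L: "L > 0"
    and lim: "(\<lambda>m. accept_prob M (replicate (L * Suc m) a) - accept_prob M (replicate (L * m) a)) \<longlonglongrightarrow> 0"
    and primes: "\<And>D. finite D \<Longrightarrow> (\<And>p. p \<in> D \<Longrightarrow> prime p \<and> p dvd L) \<Longrightarrow> \<Sum>D \<le> num_states M"
    by (rule unary_pfa_accept_prob_asymptotics[OF M]) blast
  let ?D = "{p \<in> prime_block k n. p dvd L}"
  have "real (card ?D) \<ge> real k / 3" by (rule many_block_primes_dvd_period[OF n e sol L lim])
  then have "1 / (72 * ln 8) * (real k * (real n + real k) * ln (real n)) \<le> real (\<Sum>?D)"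
    by (intro sum_prime_block_subset_ge n) auto
  also have "\<Sum>?D \<le> num_states M"
    using finite_prime_block prime_of_prime_block by (intro primes) auto
  finally show ?thesis by simp
qed

theorem theorem7:
  "\<exists>C::real. C > 0 \<and>
     (\<forall>(n::nat) (k::nat) (a::'a) (M::'a pfa) (\<epsilon>::real).
        n \<ge> 1 \<longrightarrow> k \<ge> 1 \<longrightarrow> \<epsilon> < 1 / 2 \<longrightarrow> is_pfa M \<longrightarrow>
        solves_with_error M (L_problem a k n) \<epsilon> \<longrightarrow>
        C * (real k * (real n + real k) * ln (real n)) \<le> real (num_states M))"
proof (intro exI conjI allI impI)
  show "0 < 1 / (72 * ln (8::real))" by simp
  fix n k :: nat and a :: 'a and M :: "'a pfa" and \<epsilon> :: real
  assume "n \<ge> 1" "\<epsilon> < 1 / 2" "is_pfa M" "solves_with_error M (L_problem a k n) \<epsilon>"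
  \<comment> \<open>For \<open>n = 1\<close> the factor \<open>ln n\<close> is 0 and the bound is
    trivial; from \<open>n = 2\<close> on the block consists of odd primes.\<close>
  then show "1 / (72 * ln 8) * (real k * (real n + real k) * ln (real n)) \<le> real (num_states M)"
    using num_states_lower_bound[of n \<epsilon> M a k] by (cases "n = 1") simp_all
qed

end
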